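(* Let $D$ be an admissible domain and let $h$ be sufficiently large. Let $\mathcal L_s\subset\mathcal L$ be the set of bi-infinite admissible words that are symmetric, i.e. admit a symmetry axis, and let $\tilde{\mathcal L}=\mathcal L\setminus\mathcal L_s$. Replacing $\mathcal L$ with $\tilde{\mathcal L}$ in the symbolic dynamics $\pi\circ\mathcal F=\sigma_r\circ\pi$ (hence $X$ with $\pi^{-1}(\tilde{\mathcal L})$), the symbolic dynamics is not collisional: no trajectory corresponding to a word $\underline\ell\in\tilde{\mathcal L}$ has a collisional inner arc (an inner arc passing, in the regularized sense, through the origin).
   Context: Fix constants $\omega,\mu,\mathcal E>0$. $D\subset\mathbb R^2$ is a bounded open domain containing the origin, with $\overline D\subset\{z:\|z\|<\sqrt{2\mathcal E}/\omega\}$, whose boundary is a simple closed curve $\partial D=\gamma([0,L])$, with $\gamma:[0,L]\to\mathbb R^2$ an arc-length parametrization of class (at least) $C^1$. For $h>0$ put $V_E(z)=\mathcal E-\frac{\omega^2}{2}\|z\|^2$ (outer potential) and $V_I(z)=\mathcal E+h+\frac{\mu}{\|z\|}$ (inner potential). Let $t(\xi)=\dot\gamma(\xi)$ and let $n(\xi)$ be the outward unit normal to $\partial D$ at $\gamma(\xi)$. Outer-arc property. An open interval $(a,b)\subset[0,L]$ satisfies the outer-arc property if for all $\xi_1,\xi_2\in(a,b)$ there is a unique solution $z_E(\cdot;\gamma(\xi_1),\gamma(\xi_2))$ (the outer arc), for some $T=T_E(\xi_1,\xi_2)>0$, of $z''=-\omega^2z$ and $\frac12\|z'\|^2=V_E(z)$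 on $[0,T]$, $z(s)\notin D$ for $s\in(0,T)$, $z(0)=\gamma(\xi_1)$, $z(T)=\gamma(\xi_2)$. Inner-arc property. Parameters $\xi_1,\xi_2\in[0,L]$ are antipodal if the origin belongs to the segment joining $\gamma(\xi_1)$ and $\gamma(\xi_2)$; two (possibly equal) intervals are not antipodal if no point of the first is antipodal to a point of the second. If $\xi_1,\xi_2$ are not antipodal, a continuous curve in $\mathbb R^2\setminus\{0\}$ from $\gamma(\xi_1)$ to $\gamma(\xi_2)$ is topologically non-trivial (TnT) if it is not homotopic in $\mathbb R^2\setminus\{0\}$ (with fixed endpoints) to the segment joining them. A set $\mathcal A$ satisfies the inner-arc property if: (IP0) $\mathcal A$ is a disjoint union of open intervals $(a_i,b_i)\subset[0,L]$, $i\in\mathcal I=\{1,\dots,m\}$, $m\ge2$; (IP1) for every $i$ there is $j\ne i$ such that both $(a_i,b_i)$ and $(a_j,b_j)$ are not antipodal to $(a_i,b_i)$; (IP2) there is $h_0>0$ such that for all $\xi_1,\xi_2$ belonging to two non-antipodal (possibly equal) intervals and all $h>h_0$ there is a unique TnT solution $z_I(\cdot;\gamma(\xi_1),\gamma(\xi_2);h)$ (the inner arc), for some $T=T_I(\xi_1,\xi_2;h)>0$, of $z''=-\mu z/\|z\|^3$ and $\frac12\|z'\|^2=V_I(z)$ on $[0,T]$, $z(s)\in D$ for $s\in(0,T)$, $z(0)=\gamma(\xi_1)$, $z(T)=\gamma(\xi_2)$; if $\xi_1=\xi_2$ the solution is meant in the Levi-Civita regularized sense (collision-ejection along the radial segment).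 Let $NA(i)=\{j\in\mathcal I:(a_i,b_i)\text{ and }(a_j,b_j)\text{ are not antipodal}\}$. Jacobi lengths. $S_E(\xi_1,\xi_2)=\int_0^{T_E}\|z_E'\|\sqrt{V_E(z_E)}\,ds$ and $S_I(\xi_1,\xi_2;h)=\int_0^{T_I}\|z_I'\|\sqrt{V_I(z_I)}\,ds$ along these arcs; $\partial_a,\partial_b$ are the partial derivatives in the first and second variable. Change-sign property. If $\mathcal A$ satisfies the inner-arc property and every $(a_i,b_i)$ the outer-arc property, $\mathcal A$ satisfies the change-sign property if there are $h_1\ge h_0$ and compact intervals $[\alpha_i,\beta_i]\subset(a_i,b_i)$, $i\in\mathcal I$, such that for all $h>h_1$, $i\in\mathcal I$, $\xi_E\in[\alpha_i,\beta_i]$, $\xi_I\in\bigcup_{j\in NA(i)}[\alpha_j,\beta_j]$, $$(\partial_bS_E(\xi_E,\alpha_i)+\partial_aS_I(\alpha_i,\xi_I;h))\,(\partial_bS_E(\xi_E,\beta_i)+\partial_aS_I(\beta_i,\xi_I;h))<0.$$ $D$ is admissible if $\gamma\in C^1$ and there is $\mathcal A=\bigcup_{i=1}^m(a_i,b_i)\subset[0,L]$, $m\ge2$, satisfying the inner-arc and change-sign properties and such that every $(a_i,b_i)$ satisfies the outer-arc property. Put $I^{(i)}=[\alpha_i,\beta_i]$. Return map. For $r\in\mathcal I$ let $\Xi_r^{\pm}=\{(\xi,v):\xi\in I^{(r)},\ v\in\mathbb R^2,\ \frac12\|v\|^2=V_E(\gamma(\xi)),\ \pm\langle n(\xi),v\rangle>0\}$.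 The refraction map (Snell's law $\sqrt{V_E}\sin\alpha_E=\sqrt{V_I}\sin\alpha_I$, angles from the normal) sends $v=a\,t(\xi)+b\,n(\xi)$ with $\|v\|^2=2V_E(\gamma(\xi))$ to $R_\xi(v)=a\,t(\xi)+\mathrm{sgn}(b)\sqrt{2V_I(\gamma(\xi))-a^2}\,n(\xi)$. The map $F$ is defined at $(\xi,v)\in\Xi_r^+$, $r\in\mathcal I$, if: (i) the solution of $z''=-\omega^2z$ with initial data $(\gamma(\xi),v)$ is outside $\overline D$ for $s\in(0,s_1)$ and at time $s_1>0$ has position and velocity $(\gamma(\xi_1),v_1)$ with $(\xi_1,v_1)\in\Xi_r^-$; (ii) the (regularized) solution of $z''=-\mu z/\|z\|^3$ with initial data $(\gamma(\xi_1),R_{\xi_1}(v_1))$ stays in $D$ for $s\in(0,s_2)$ and at time $s_2>0$ has position and velocity $(\gamma(\xi_2),R_{\xi_2}(v_2))$ with $(\xi_2,v_2)\in\Xi_{r'}^+$ for some $r'\in NA(r)$. Then $F(\xi,v)=(\xi_2,v_2)$. $X$ is the set of $(\xi,v)$ at which all iterates $F^k$, $k\in\mathbb Z$, are defined, with the Euclidean metric of $\mathbb R^3$, and $\mathcal F=F|_X$. Words. $\mathcal L=\{\underline\ell=(\ell_j)_{j\in\mathbb Z}\in\mathcal I^{\mathbb Z}:\ell_{j+1}\in NA(\ell_j)\ \forall j\}$. Put $\chi(\xi,v)=r$ iff $\xi\in I^{(r)}$ and $\pi(\xi,v)=(\chi(\mathcal F^j(\xi,v)))_{j\in\mathbb Z}$.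 The shift is $(\sigma_r\underline\ell)_j=\ell_{j+1}$. A word $\underline\ell\in\mathcal L$ admits a symmetry axis if there is $c\in\mathbb Z$ with $\ell_{c-k}=\ell_k$ for all $k\in\mathbb Z$ (the axis may pass through a symbol or between two symbols). The trajectory corresponding to $\underline\ell$ is the one generated by an initial condition $(\xi,v)\in X$ with $\pi(\xi,v)=\underline\ell$. *)

theory Defs
  imports "HOL-Analysis.Analysis"
begin

text \<open>The plane is identified with \<^typ>\<open>complex\<close>, the origin being the Kepler centre.\<close>

record billiard =
  omega :: real
  mu :: real
  energy :: real
  region :: "complex set"
  bdry :: "real \<Rightarrow> complex"
  bdry_len :: real

definition refraction_domain :: "billiard \<Rightarrow> bool" where
  "refraction_domain B \<longleftrightarrow>
     omega B > 0 \<and> mu B > 0 \<and> energy B > 0 \<and>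
     open (region B) \<and> connected (region B) \<and> bounded (region B) \<and> 0 \<in> region B \<and>
     closure (region B) \<subseteq> {z. norm z < sqrt (2 * energy B) / omega B} \<and>
     bdry_len B > 0 \<and>
     frontier (region B) = bdry B ` {0..bdry_len B} \<and>
     bdry B 0 = bdry B (bdry_len B) \<and> inj_on (bdry B) {0..<bdry_len B} \<and>
     (\<exists>t. continuous_on {0..bdry_len B} t \<and>
       (\<forall>\<xi>\<in>{0..bdry_len B}. norm (t \<xi>) = 1 \<and>
          (bdry B has_vector_derivative t \<xi>) (at \<xi> within {0..bdry_len B})))"

definition V_E :: "billiard \<Rightarrow> complex \<Rightarrow> real" where
  "V_E B z = energy B - (omega B)\<^sup>2 / 2 * (norm z)\<^sup>2"

definition V_I :: "billiard \<Rightarrow> real \<Rightarrow> complex \<Rightarrow> real" where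
  "V_I B h z = energy B + h + mu B / norm z"

definition tangent :: "billiard \<Rightarrow> real \<Rightarrow> complex" where
  "tangent B \<xi> = vector_derivative (bdry B) (at \<xi> within {0..bdry_len B})"

text \<open>Of the two unit normals, the one that points out of the domain. No orientation of the
  boundary curve is assumed.\<close>

definition normal_out :: "billiard \<Rightarrow> real \<Rightarrow> complex" where
  "normal_out B \<xi> =
     (let n = - \<i> * tangent B \<xi>
      in if \<forall>\<^sub>F s in at_right 0. bdry B \<xi> + s *\<^sub>R n \<notin> closure (region B) then n else - n)"

subsection \<open>Motions and arcs\<close>

definition motion ::
  "(complex \<Rightarrow> complex) \<Rightarrow> (complex \<Rightarrow> real) \<Rightarrow> real \<Rightarrow> (real \<Rightarrow> complex) \<Rightarrow> bool" where
  "motion f V T z \<longleftrightarrow>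
     (\<exists>v. \<forall>s\<in>{0..T}.
        (z has_vector_derivative v s) (at s within {0..T}) \<and>
        (v has_vector_derivative f (z s)) (at s within {0..T}) \<and>
        (norm (v s))\<^sup>2 / 2 = V (z s))"

definition outer_motion :: "billiard \<Rightarrow> real \<Rightarrow> (real \<Rightarrow> complex) \<Rightarrow> bool" where
  "outer_motion B T z \<longleftrightarrow> motion (\<lambda>z. - ((omega B)\<^sup>2 *\<^sub>R z)) (V_E B) T z"

definition inner_motion :: "billiard \<Rightarrow> real \<Rightarrow> real \<Rightarrow> (real \<Rightarrow> complex) \<Rightarrow> bool" where
  "inner_motion B h T z \<longleftrightarrow>
     (\<forall>s\<in>{0..T}. z s \<noteq> 0) \<and> motion (\<lambda>z. - ((mu B / norm z ^ 3) *\<^sub>R z)) (V_I B h) T z"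

text \<open>Levi-Civita regularization at energy \<open>H = energy B + h\<close>: putting \<open>z = w\<^sup>2\<close> and
  \<open>dt = |z| d\<tau>\<close>, the Kepler equation becomes \<open>w'' = (H / 2) w\<close> and the energy relation
  \<open>|z'|\<^sup>2 / 2 = H + mu / |z|\<close> becomes \<open>2 |w'|\<^sup>2 = H |w|\<^sup>2 + mu\<close>; both are regular at \<open>w = 0\<close>.\<close>

definition regularized_motion :: "billiard \<Rightarrow> real \<Rightarrow> real \<Rightarrow> (real \<Rightarrow> complex) \<Rightarrow> bool" where
  "regularized_motion B h T z \<longleftrightarrow>
     (\<exists>S w w'. S > 0 \<and>
        (\<forall>\<tau>\<in>{0..S}.
           (w has_vector_derivative w' \<tau>) (at \<tau> within {0..S}) \<and>
           (w' has_vector_derivative ((energy B + h) / 2) *\<^sub>R w \<tau>) (at \<tau> within {0..S}) \<and>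
           2 * (norm (w' \<tau>))\<^sup>2 = (energy B + h) * (norm (w \<tau>))\<^sup>2 + mu B \<and>
           z (integral {0..\<tau>} (\<lambda>\<theta>. (norm (w \<theta>))\<^sup>2)) = (w \<tau>)\<^sup>2) \<and>
        T = integral {0..S} (\<lambda>\<theta>. (norm (w \<theta>))\<^sup>2))"

definition unique_arc :: "(real \<Rightarrow> (real \<Rightarrow> complex) \<Rightarrow> bool) \<Rightarrow> bool" where
  "unique_arc P \<longleftrightarrow>
     (\<exists>T z. P T z \<and> (\<forall>T' z'. P T' z' \<longrightarrow> T' = T \<and> (\<forall>s\<in>{0..T}. z' s = z s)))"

definition outer_arc ::
  "billiard \<Rightarrow> real \<Rightarrow> real \<Rightarrow> real \<Rightarrow> (real \<Rightarrow> complex) \<Rightarrow> bool" where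
  "outer_arc B \<xi>\<^sub>1 \<xi>\<^sub>2 T z \<longleftrightarrow>
     T > 0 \<and> outer_motion B T z \<and> (\<forall>s\<in>{0<..<T}. z s \<notin> region B) \<and>
     z 0 = bdry B \<xi>\<^sub>1 \<and> z T = bdry B \<xi>\<^sub>2"

definition topologically_nontrivial :: "real \<Rightarrow> (real \<Rightarrow> complex) \<Rightarrow> bool" where
  "topologically_nontrivial T z \<longleftrightarrow>
     \<not> homotopic_paths (- {0}) (\<lambda>u. z (T * u)) (linepath (z 0) (z T))"

text \<open>For equal endpoints the inner arc is the collision-ejection arc, which runs along the radial
  segment from the boundary point to the origin and back.\<close>

definition inner_arc ::
  "billiard \<Rightarrow> real \<Rightarrow> real \<Rightarrow> real \<Rightarrow> real \<Rightarrow> (real \<Rightarrow> complex) \<Rightarrow> bool" where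
  "inner_arc B h \<xi>\<^sub>1 \<xi>\<^sub>2 T z \<longleftrightarrow>
     T > 0 \<and> (\<forall>s\<in>{0<..<T}. z s \<in> region B) \<and>
     z 0 = bdry B \<xi>\<^sub>1 \<and> z T = bdry B \<xi>\<^sub>2 \<and>
     (if \<xi>\<^sub>1 = \<xi>\<^sub>2
      then regularized_motion B h T z \<and> z ` {0..T} = closed_segment 0 (bdry B \<xi>\<^sub>1)
      else inner_motion B h T z \<and> topologically_nontrivial T z)"

definition jacobi_length :: "(complex \<Rightarrow> real) \<Rightarrow> real \<Rightarrow> (real \<Rightarrow> complex) \<Rightarrow> real" where
  "jacobi_length V T z =
     integral {0..T} (\<lambda>s. norm (vector_derivative z (at s within {0..T})) * sqrt (V (z s)))"

definition S_E :: "billiard \<Rightarrow> real \<Rightarrow> real \<Rightarrow> real" where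
  "S_E B \<xi>\<^sub>1 \<xi>\<^sub>2 = (THE S. \<exists>T z. outer_arc B \<xi>\<^sub>1 \<xi>\<^sub>2 T z \<and> S = jacobi_length (V_E B) T z)"

definition S_I :: "billiard \<Rightarrow> real \<Rightarrow> real \<Rightarrow> real \<Rightarrow> real" where
  "S_I B h \<xi>\<^sub>1 \<xi>\<^sub>2 = (THE S. \<exists>T z. inner_arc B h \<xi>\<^sub>1 \<xi>\<^sub>2 T z \<and> S = jacobi_length (V_I B h) T z)"

subsection \<open>Admissibility\<close>

text \<open>A family of open intervals \<open>(lo i, hi i)\<close> with compact subintervals \<open>[lo' i, hi' i]\<close>,
  indexed by \<open>i \<in> {1..size_of}\<close>.\<close>

record arc_family =
  size_of :: nat
  lo :: "nat \<Rightarrow> real"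
  hi :: "nat \<Rightarrow> real"
  lo' :: "nat \<Rightarrow> real"
  hi' :: "nat \<Rightarrow> real"

definition indices :: "arc_family \<Rightarrow> nat set" where
  "indices A = {1..size_of A}"

definition opn :: "arc_family \<Rightarrow> nat \<Rightarrow> real set" where
  "opn A i = {lo A i<..<hi A i}"

definition cpt :: "arc_family \<Rightarrow> nat \<Rightarrow> real set" where
  "cpt A i = {lo' A i..hi' A i}"

definition antipodal :: "billiard \<Rightarrow> real \<Rightarrow> real \<Rightarrow> bool" where
  "antipodal B \<xi>\<^sub>1 \<xi>\<^sub>2 \<longleftrightarrow> 0 \<in> closed_segment (bdry B \<xi>\<^sub>1) (bdry B \<xi>\<^sub>2)"

definition not_antipodal_sets :: "billiard \<Rightarrow> real set \<Rightarrow> real set \<Rightarrow> bool" where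
  "not_antipodal_sets B U W \<longleftrightarrow> (\<forall>\<xi>\<^sub>1\<in>U. \<forall>\<xi>\<^sub>2\<in>W. \<not> antipodal B \<xi>\<^sub>1 \<xi>\<^sub>2)"

definition NA :: "billiard \<Rightarrow> arc_family \<Rightarrow> nat \<Rightarrow> nat set" where
  "NA B A i = {j \<in> indices A. not_antipodal_sets B (opn A i) (opn A j)}"

definition outer_arc_property :: "billiard \<Rightarrow> real set \<Rightarrow> bool" where
  "outer_arc_property B U \<longleftrightarrow> (\<forall>\<xi>\<^sub>1\<in>U. \<forall>\<xi>\<^sub>2\<in>U. unique_arc (outer_arc B \<xi>\<^sub>1 \<xi>\<^sub>2))"

definition IP0 :: "billiard \<Rightarrow> arc_family \<Rightarrow> bool" where
  "IP0 B A \<longleftrightarrow>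
     size_of A \<ge> 2 \<and>
     (\<forall>i\<in>indices A. lo A i < hi A i \<and> opn A i \<subseteq> {0..bdry_len B}) \<and>
     (\<forall>i\<in>indices A. \<forall>j\<in>indices A. i \<noteq> j \<longrightarrow> opn A i \<inter> opn A j = {})"

definition IP1 :: "billiard \<Rightarrow> arc_family \<Rightarrow> bool" where
  "IP1 B A \<longleftrightarrow>
     (\<forall>i\<in>indices A. \<exists>j\<in>indices A. j \<noteq> i \<and>
        not_antipodal_sets B (opn A i) (opn A i) \<and> not_antipodal_sets B (opn A j) (opn A i))"

definition IP2 :: "billiard \<Rightarrow> arc_family \<Rightarrow> real \<Rightarrow> bool" where
  "IP2 B A h\<^sub>0 \<longleftrightarrow>
     h\<^sub>0 > 0 \<and>
     (\<forall>i\<in>indices A. \<forall>j\<in>NA B A i. \<forall>\<xi>\<^sub>1\<in>opn A i. \<forall>\<xi>\<^sub>2\<in>opn A j. \<forall>h>h\<^sub>0.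
        unique_arc (inner_arc B h \<xi>\<^sub>1 \<xi>\<^sub>2))"

definition inner_arc_property :: "billiard \<Rightarrow> arc_family \<Rightarrow> bool" where
  "inner_arc_property B A \<longleftrightarrow> IP0 B A \<and> IP1 B A \<and> (\<exists>h\<^sub>0. IP2 B A h\<^sub>0)"

definition change_sign_property :: "billiard \<Rightarrow> arc_family \<Rightarrow> bool" where
  "change_sign_property B A \<longleftrightarrow>
     (\<forall>i\<in>indices A. lo A i < lo' A i \<and> lo' A i < hi' A i \<and> hi' A i < hi A i) \<and>
     (\<exists>h\<^sub>0 h\<^sub>1. IP2 B A h\<^sub>0 \<and> h\<^sub>1 \<ge> h\<^sub>0 \<and>
        (\<forall>h>h\<^sub>1. \<forall>i\<in>indices A. \<forall>\<xi>\<^sub>E\<in>cpt A i. \<forall>\<xi>\<^sub>I\<in>(\<Union>j\<in>NA B A i. cpt A j).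
           \<exists>p q p' q'.
             ((\<lambda>x. S_E B \<xi>\<^sub>E x) has_real_derivative p) (at (lo' A i)) \<and>
             ((\<lambda>x. S_I B h x \<xi>\<^sub>I) has_real_derivative q) (at (lo' A i)) \<and>
             ((\<lambda>x. S_E B \<xi>\<^sub>E x) has_real_derivative p') (at (hi' A i)) \<and>
             ((\<lambda>x. S_I B h x \<xi>\<^sub>I) has_real_derivative q') (at (hi' A i)) \<and>
             (p + q) * (p' + q') < 0))"

definition admissible_family :: "billiard \<Rightarrow> arc_family \<Rightarrow> bool" where
  "admissible_family B A \<longleftrightarrow>
     inner_arc_property B A \<and> (\<forall>i\<in>indices A. outer_arc_property B (opn A i)) \<and>
     change_sign_property B A"

definition admissible :: "billiard \<Rightarrow> bool" where
  "admissible B \<longleftrightarrow> (\<exists>A. admissible_family B A)"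

subsection \<open>The return map\<close>

type_synonym state = "real \<times> complex"

definition Xi_out :: "billiard \<Rightarrow> arc_family \<Rightarrow> nat \<Rightarrow> state set" where
  "Xi_out B A r = {(\<xi>, v). \<xi> \<in> cpt A r \<and> (norm v)\<^sup>2 / 2 = V_E B (bdry B \<xi>) \<and>
     normal_out B \<xi> \<bullet> v > 0}"

definition Xi_in :: "billiard \<Rightarrow> arc_family \<Rightarrow> nat \<Rightarrow> state set" where
  "Xi_in B A r = {(\<xi>, v). \<xi> \<in> cpt A r \<and> (norm v)\<^sup>2 / 2 = V_E B (bdry B \<xi>) \<and>
     normal_out B \<xi> \<bullet> v < 0}"

definition refract :: "billiard \<Rightarrow> real \<Rightarrow> state \<Rightarrow> complex" where
  "refract B h = (\<lambda>(\<xi>, v).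
     (let a = v \<bullet> tangent B \<xi>; b = v \<bullet> normal_out B \<xi>
      in a *\<^sub>R tangent B \<xi> +
         (sgn b * sqrt (2 * V_I B h (bdry B \<xi>) - a\<^sup>2)) *\<^sub>R normal_out B \<xi>))"

definition outer_leg :: "billiard \<Rightarrow> state \<Rightarrow> state \<Rightarrow> bool" where
  "outer_leg B x p \<longleftrightarrow>
     (\<exists>T z. T > 0 \<and> outer_motion B T z \<and> (\<forall>s\<in>{0<..<T}. z s \<notin> closure (region B)) \<and>
        z 0 = bdry B (fst x) \<and> (z has_vector_derivative snd x) (at 0 within {0..T}) \<and>
        z T = bdry B (fst p) \<and> (z has_vector_derivative snd p) (at T within {0..T}))"

definition inner_leg ::
  "billiard \<Rightarrow> real \<Rightarrow> state \<Rightarrow> state \<Rightarrow> real \<Rightarrow> (real \<Rightarrow> complex) \<Rightarrow> bool" where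
  "inner_leg B h p y T z \<longleftrightarrow>
     T > 0 \<and> regularized_motion B h T z \<and> (\<forall>s\<in>{0<..<T}. z s \<in> region B) \<and>
     z 0 = bdry B (fst p) \<and> (z has_vector_derivative refract B h p) (at 0 within {0..T}) \<and>
     z T = bdry B (fst y) \<and> (z has_vector_derivative refract B h y) (at T within {0..T})"

text \<open>\<open>z\<close> on \<open>[0, T]\<close> is the inner arc of the trajectory travelled between \<open>x\<close> and \<open>y = F x\<close>.\<close>

definition return_step ::
  "billiard \<Rightarrow> arc_family \<Rightarrow> real \<Rightarrow> state \<Rightarrow> state \<Rightarrow> real \<Rightarrow> (real \<Rightarrow> complex) \<Rightarrow> bool" where
  "return_step B A h x y T z \<longleftrightarrow>
     (\<exists>r\<in>indices A. \<exists>r'\<in>NA B A r. \<exists>p.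
        x \<in> Xi_out B A r \<and> p \<in> Xi_in B A r \<and> y \<in> Xi_out B A r' \<and>
        outer_leg B x p \<and> inner_leg B h p y T z)"

definition collisional :: "real \<Rightarrow> (real \<Rightarrow> complex) \<Rightarrow> bool" where
  "collisional T z \<longleftrightarrow> (\<exists>s\<in>{0..T}. z s = 0)"

definition return_dom :: "billiard \<Rightarrow> arc_family \<Rightarrow> real \<Rightarrow> state set" where
  "return_dom B A h = {x. \<exists>y T z. return_step B A h x y T z}"

definition return_map :: "billiard \<Rightarrow> arc_family \<Rightarrow> real \<Rightarrow> state \<Rightarrow> state" where
  "return_map B A h x = (THE y. \<exists>T z. return_step B A h x y T z)"

definition return_inv :: "billiard \<Rightarrow> arc_family \<Rightarrow> real \<Rightarrow> state \<Rightarrow> state" where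
  "return_inv B A h = inv_into (return_dom B A h) (return_map B A h)"

definition return_iter :: "billiard \<Rightarrow> arc_family \<Rightarrow> real \<Rightarrow> int \<Rightarrow> state \<Rightarrow> state" where
  "return_iter B A h k =
     (if k \<ge> 0 then return_map B A h ^^ nat k else return_inv B A h ^^ nat (- k))"

definition invariant_set :: "billiard \<Rightarrow> arc_family \<Rightarrow> real \<Rightarrow> state set" where
  "invariant_set B A h =
     {x. \<forall>n. (return_map B A h ^^ n) x \<in> return_dom B A h \<and>
             (return_inv B A h ^^ n) x \<in> return_map B A h ` return_dom B A h}"

subsection \<open>Words\<close>

type_synonym word = "int \<Rightarrow> nat"

definition words :: "billiard \<Rightarrow> arc_family \<Rightarrow> word set" where
  "words B A = {l. \<forall>j. l j \<in> indices A \<and> l (j + 1) \<in> NA B A (l j)}"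

definition symmetric_words :: "billiard \<Rightarrow> arc_family \<Rightarrow> word set" where
  "symmetric_words B A = {l \<in> words B A. \<exists>c. \<forall>k. l (c - k) = l k}"

definition shift :: "word \<Rightarrow> word" where
  "shift l = (\<lambda>j. l (j + 1))"

definition symbol :: "arc_family \<Rightarrow> state \<Rightarrow> nat" where
  "symbol A x = (THE r. r \<in> indices A \<and> fst x \<in> cpt A r)"

definition coding :: "billiard \<Rightarrow> arc_family \<Rightarrow> real \<Rightarrow> state \<Rightarrow> word" where
  "coding B A h x = (\<lambda>j. symbol A (return_iter B A h j x))"

definition asymmetric_set :: "billiard \<Rightarrow> arc_family \<Rightarrow> real \<Rightarrow> state set" where
  "asymmetric_set B A h =
     {x \<in> invariant_set B A h. coding B A h x \<in> words B A - symmetric_words B A}"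

end

theory Submission
  imports Defs
begin

text \<open>In Levi-Civita coordinates the regularized Kepler flow is the linear equation
  \<open>w'' = (H / 2) w\<close>, so a motion through the origin stays on a ray and is even in time about the
  collision. As the whole inner arc lies in the domain, a collisional inner arc returns to its
  starting point with the opposite velocity. The return dynamics is reversible under
  \<open>v \<mapsto> -v\<close> and deterministic in both time directions, so the orbit then runs back through its
  own past: if the collision occurs between the states of index \<open>k\<close> and \<open>k + 1\<close>, the states of
  index \<open>k + 1 + j\<close> and \<open>k - j\<close> lie in the same interval for all \<open>j\<close>, and the word is symmetric about
  \<open>k + 1/2\<close>.\<close>

subsection \<open>Oscillators and the Levi-Civita lift\<close>

lemma has_vector_derivative_unique_Icc:
  fixes f :: "real \<Rightarrow> 'a::real_normed_vector"
  assumes "a < b" "x \<in> {a..b}"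
    and "(f has_vector_derivative d) (at x within {a..b})"
    and "(f has_vector_derivative e) (at x within {a..b})"
  shows "d = e"
  using vector_derivative_unique_within[OF _ assms(3,4)] assms(1,2)
  by (auto simp: trivial_limit_within intro!: islimpt_closure_open[where s = "{a <..< b}"])

lemma constant_on_Icc:
  fixes f :: "real \<Rightarrow> 'a::real_normed_vector"
  assumes "\<And>x. x \<in> {a..b} \<Longrightarrow> (f has_vector_derivative 0) (at x within {a..b})"
    and "x \<in> {a..b}" "y \<in> {a..b}"
  shows "f x = f y"
  using has_vector_derivative_zero_constant[OF convex_real_interval(5) assms(1)] assms(2,3)
  by metis

text \<open>The reflection maps \<open>{0..T}\<close> onto itself and exchanges its ends, so
  one-sided end velocities are covered. All time reversals below rest on this.\<close>

lemma has_vector_derivative_reflect: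
  fixes f :: "real \<Rightarrow> 'a::real_normed_vector"
  assumes "(f has_vector_derivative d) (at (T - s) within {0..T})"
  shows "((\<lambda>s. f (T - s)) has_vector_derivative - d) (at s within {0..T})"
proof -
  have im: "(\<lambda>s. T - s) ` {0..T} = {0..T}"
    by (auto simp: image_def intro!: bexI[of _ "T - _"])
  have "((\<lambda>s. T - s) has_vector_derivative - 1) (at s within {0..T})"
    by (auto intro!: derivative_eq_intros)
  then have "((f \<circ> (\<lambda>s. T - s)) has_vector_derivative (- 1) *\<^sub>R d) (at s within {0..T})"
    by (rule vector_diff_chain_within) (use assms im in simp)
  then show ?thesis
    by (simp add: o_def)
qed

text \<open>The energy \<open>Q\<close> of the difference of the two solutions is conserved, starts
  at 0 and is a sum of nonnegative terms.\<close>

lemma harmonic_oscillator_unique: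
  fixes z\<^sub>1 z\<^sub>2 v\<^sub>1 v\<^sub>2 :: "real \<Rightarrow> 'a::real_inner"
  assumes "k > 0"
    and 1: "\<And>s. s \<in> {0..T} \<Longrightarrow> (z\<^sub>1 has_vector_derivative v\<^sub>1 s) (at s within {0..T}) \<and>
      (v\<^sub>1 has_vector_derivative - (k *\<^sub>R z\<^sub>1 s)) (at s within {0..T})"
    and 2: "\<And>s. s \<in> {0..T} \<Longrightarrow> (z\<^sub>2 has_vector_derivative v\<^sub>2 s) (at s within {0..T}) \<and>
      (v\<^sub>2 has_vector_derivative - (k *\<^sub>R z\<^sub>2 s)) (at s within {0..T})"
    and init: "z\<^sub>1 0 = z\<^sub>2 0" "v\<^sub>1 0 = v\<^sub>2 0"
    and s: "s \<in> {0..T}"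
  shows "z\<^sub>1 s = z\<^sub>2 s \<and> v\<^sub>1 s = v\<^sub>2 s"
proof -
  define d where "d s = z\<^sub>1 s - z\<^sub>2 s" for s
  define e where "e s = v\<^sub>1 s - v\<^sub>2 s" for s
  define Q where "Q s = k * (d s \<bullet> d s) + e s \<bullet> e s" for s
  have "(Q has_vector_derivative 0) (at s within {0..T})" if "s \<in> {0..T}" for s
  proof -
    have d: "(d has_vector_derivative e s) (at s within {0..T})"
      unfolding d_def e_def using 1[OF that] 2[OF that]
      by (auto intro!: derivative_eq_intros)
    have e: "(e has_vector_derivative - (k *\<^sub>R d s)) (at s within {0..T})"
      unfolding d_def e_def using 1[OF that] 2[OF that]
      by (auto intro!: derivative_eq_intros simp: scaleR_diff_right)
    note ip = bounded_bilinear.has_vector_derivative[OF bounded_bilinear_inner]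
    have "(Q has_vector_derivative k * (d s \<bullet> e s + e s \<bullet> d s) +
        (e s \<bullet> - (k *\<^sub>R d s) + - (k *\<^sub>R d s) \<bullet> e s)) (at s within {0..T})"
      unfolding Q_def
      by (intro has_vector_derivative_add has_vector_derivative_mult_right ip d e)
    then show ?thesis
      by (rule has_vector_derivative_eq_rhs) (simp add: inner_commute algebra_simps)
  qed
  then have "Q s = Q 0"
    by (rule constant_on_Icc[where a = 0 and b = T]) (use s in auto)
  then have "k * (d s \<bullet> d s) + e s \<bullet> e s = 0"
    by (simp add: Q_def d_def e_def init)
  moreover have "k * (d s \<bullet> d s) \<ge> 0" "e s \<bullet> e s \<ge> 0"
    using \<open>k > 0\<close> by auto
  ultimately have "k * (d s \<bullet> d s) = 0" "e s \<bullet> e s = 0"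
    by linarith+
  then show ?thesis
    using \<open>k > 0\<close> by (auto simp: d_def e_def)
qed

text \<open>The energy of this equation is indefinite, so the flow is inverted explicitly instead.
  The base point \<open>a\<close> is free because it will be either an initial time or the time of
  collision.\<close>

lemma hyperbolic_oscillator_solution:
  fixes w w' :: "real \<Rightarrow> 'a::real_normed_vector"
  assumes "k > 0"
    and w: "\<And>\<tau>. \<tau> \<in> {0..S} \<Longrightarrow> (w has_vector_derivative w' \<tau>) (at \<tau> within {0..S})"
    and w': "\<And>\<tau>. \<tau> \<in> {0..S} \<Longrightarrow> (w' has_vector_derivative k\<^sup>2 *\<^sub>R w \<tau>) (at \<tau> within {0..S})"
    and a: "a \<in> {0..S}" and \<tau>: "\<tau> \<in> {0..S}"
  shows "w \<tau> = cosh (k * (\<tau> - a)) *\<^sub>R w a + (sinh (k * (\<tau> - a)) / k) *\<^sub>R w' a"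
    and "w' \<tau> = (k * sinh (k * (\<tau> - a))) *\<^sub>R w a + cosh (k * (\<tau> - a)) *\<^sub>R w' a"
proof -
  define c where "c \<tau> = cosh (k * (\<tau> - a))" for \<tau>
  define s where "s \<tau> = sinh (k * (\<tau> - a))" for \<tau>
  have c: "(c has_field_derivative k * s \<tau>) (at \<tau> within {0..S})" for \<tau>
    unfolding c_def s_def by (auto intro!: derivative_eq_intros)
  have s: "(s has_field_derivative k * c \<tau>) (at \<tau> within {0..S})" for \<tau>
    unfolding c_def s_def by (auto intro!: derivative_eq_intros)
  have cs: "c \<tau> * c \<tau> - s \<tau> * s \<tau> = 1" for \<tau>
    unfolding c_def s_def using hyperbolic_pythagoras[of "k * (\<tau> - a)"]
    by (simp add: power2_eq_square)
  have [simp]: "c a = 1" "s a = 0"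
    by (auto simp: c_def s_def)
  \<comment> \<open>\<open>A\<close> and \<open>D\<close> are position and velocity transported back
    from \<open>\<tau>\<close> to \<open>a\<close> by the flow; both are constant, and
    \<open>cs\<close> inverts the transport.\<close>
  define A where "A \<tau> = c \<tau> *\<^sub>R w \<tau> - (s \<tau> / k) *\<^sub>R w' \<tau>" for \<tau>
  define D where "D \<tau> = c \<tau> *\<^sub>R w' \<tau> - (k * s \<tau>) *\<^sub>R w \<tau>" for \<tau>
  have "A \<tau> = A a"
  proof (rule constant_on_Icc[where a = 0 and b = S])
    fix t assume t: "t \<in> {0..S}"
    have "(A has_vector_derivative (c t *\<^sub>R w' t + (k * s t) *\<^sub>R w t) -
        ((s t / k) *\<^sub>R (k\<^sup>2 *\<^sub>R w t) + (k * c t / k) *\<^sub>R w' t)) (at t within {0..S})"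
      unfolding A_def
      by (intro has_vector_derivative_diff has_vector_derivative_scaleR DERIV_cdivide DERIV_cmult
          c s w[OF t] w'[OF t])
    then show "(A has_vector_derivative 0) (at t within {0..S})"
      by (rule has_vector_derivative_eq_rhs)
        (use \<open>k > 0\<close> in \<open>simp add: power2_eq_square algebra_simps\<close>)
  qed (use a \<tau> in auto)
  moreover have "D \<tau> = D a"
  proof (rule constant_on_Icc[where a = 0 and b = S])
    fix t assume t: "t \<in> {0..S}"
    have "(D has_vector_derivative (c t *\<^sub>R (k\<^sup>2 *\<^sub>R w t) + (k * s t) *\<^sub>R w' t) -
        ((k * s t) *\<^sub>R w' t + (k * (k * c t)) *\<^sub>R w t)) (at t within {0..S})"
      unfolding D_def
      by (intro has_vector_derivative_diff has_vector_derivative_scaleR DERIV_cdivide DERIV_cmult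
          c s w[OF t] w'[OF t])
    then show "(D has_vector_derivative 0) (at t within {0..S})"
      by (rule has_vector_derivative_eq_rhs)
        (use \<open>k > 0\<close> in \<open>simp add: power2_eq_square algebra_simps\<close>)
  qed (use a \<tau> in auto)
  ultimately have A: "A \<tau> = w a" and D: "D \<tau> = w' a"
    by (auto simp: A_def D_def)
  have "c \<tau> *\<^sub>R A \<tau> + (s \<tau> / k) *\<^sub>R D \<tau> = (c \<tau> * c \<tau> - s \<tau> * s \<tau>) *\<^sub>R w \<tau>"
    using \<open>k > 0\<close> by (simp add: A_def D_def algebra_simps)
  then show "w \<tau> = cosh (k * (\<tau> - a)) *\<^sub>R w a + (sinh (k * (\<tau> - a)) / k) *\<^sub>R w' a"
    unfolding A D cs by (simp add: c_def s_def)
  have "(k * s \<tau>) *\<^sub>R A \<tau> + c \<tau> *\<^sub>R D \<tau> = (c \<tau> * c \<tau> - s \<tau> * s \<tau>) *\<^sub>R w' \<tau>"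
    using \<open>k > 0\<close> by (simp add: A_def D_def algebra_simps)
  then show "w' \<tau> = (k * sinh (k * (\<tau> - a))) *\<^sub>R w a + cosh (k * (\<tau> - a)) *\<^sub>R w' a"
    unfolding A D cs by (simp add: c_def s_def)
qed

section \<open>Regularized Kepler motion in fictitious time\<close>

locale levi_civita =
  fixes H m T :: real and z :: "real \<Rightarrow> complex" and S :: real and w w' :: "real \<Rightarrow> complex"
  assumes H_pos: "H > 0" and m_pos: "m > 0" and S_pos: "S > 0"
    and w: "\<And>\<tau>. \<tau> \<in> {0..S} \<Longrightarrow> (w has_vector_derivative w' \<tau>) (at \<tau> within {0..S})"
    and w': "\<And>\<tau>. \<tau> \<in> {0..S} \<Longrightarrow> (w' has_vector_derivative (H / 2) *\<^sub>R w \<tau>) (at \<tau> within {0..S})"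
    and energy: "\<And>\<tau>. \<tau> \<in> {0..S} \<Longrightarrow> 2 * (norm (w' \<tau>))\<^sup>2 = H * (norm (w \<tau>))\<^sup>2 + m"
    and position: "\<And>\<tau>. \<tau> \<in> {0..S} \<Longrightarrow> z (integral {0..\<tau>} (\<lambda>\<theta>. (norm (w \<theta>))\<^sup>2)) = (w \<tau>)\<^sup>2"
    and duration: "T = integral {0..S} (\<lambda>\<theta>. (norm (w \<theta>))\<^sup>2)"
begin

text \<open>Physical time as a function of the fictitious time: the integrated form of dt = |z|
  d\<tau> with |z| = |w|^2.\<close>

definition clock :: "real \<Rightarrow> real" where
  "clock \<tau> = integral {0..\<tau>} (\<lambda>\<theta>. (norm (w \<theta>))\<^sup>2)"

definition rate :: real where
  "rate = sqrt (H / 2)"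

lemma rate: "rate > 0" "rate\<^sup>2 = H / 2"
  using H_pos by (auto simp: rate_def)

lemma clock_0 [simp]: "clock 0 = 0"
  and clock_S [simp]: "clock S = T"
  by (auto simp: clock_def duration)

lemma z_clock: "\<tau> \<in> {0..S} \<Longrightarrow> z (clock \<tau>) = (w \<tau>)\<^sup>2"
  using position by (simp add: clock_def)

lemma continuous_norm_w: "continuous_on {0..S} (\<lambda>\<theta>. (norm (w \<theta>))\<^sup>2)"
proof -
  have "continuous_on {0..S} w"
    by (rule continuous_on_vector_derivative[OF w])
  then show ?thesis
    by (intro continuous_intros)
qed

lemma clock_derivative:
  "\<tau> \<in> {0..S} \<Longrightarrow> (clock has_vector_derivative (norm (w \<tau>))\<^sup>2) (at \<tau> within {0..S})"
  unfolding clock_def using integral_has_vector_derivative[OF continuous_norm_w] by simp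

lemma solution:
  assumes "a \<in> {0..S}" "\<tau> \<in> {0..S}"
  shows "w \<tau> = cosh (rate * (\<tau> - a)) *\<^sub>R w a + (sinh (rate * (\<tau> - a)) / rate) *\<^sub>R w' a"
    and "w' \<tau> = (rate * sinh (rate * (\<tau> - a))) *\<^sub>R w a + cosh (rate * (\<tau> - a)) *\<^sub>R w' a"
  using hyperbolic_oscillator_solution[OF rate(1) w w'[folded rate(2)] assms] by simp_all

text \<open>The integrand vanishes only at collisions, and these cannot fill an interval: there
  \<open>w\<close> and \<open>w'\<close> would both vanish, against the energy relation with
  \<open>m > 0\<close>.\<close>

lemma clock_less:
  assumes "0 \<le> \<sigma>" "\<sigma> < \<tau>" "\<tau> \<le> S"
  shows "clock \<sigma> < clock \<tau>"
proof -
  have cont: "continuous_on {\<sigma>..\<tau>} (\<lambda>\<theta>. (norm (w \<theta>))\<^sup>2)"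
    by (rule continuous_on_subset[OF continuous_norm_w]) (use assms in auto)
  have "integral {0..\<sigma>} (\<lambda>\<theta>. (norm (w \<theta>))\<^sup>2) + integral {\<sigma>..\<tau>} (\<lambda>\<theta>. (norm (w \<theta>))\<^sup>2) = clock \<tau>"
    unfolding clock_def
    by (rule Henstock_Kurzweil_Integration.integral_combine)
      (use assms continuous_on_subset[OF continuous_norm_w, of "{0..\<tau>}"]
       in \<open>auto intro!: integrable_continuous_real\<close>)
  then have eq: "clock \<tau> = clock \<sigma> + integral {\<sigma>..\<tau>} (\<lambda>\<theta>. (norm (w \<theta>))\<^sup>2)"
    by (simp add: clock_def)
  have "integral {\<sigma>..\<tau>} (\<lambda>\<theta>. (norm (w \<theta>))\<^sup>2) \<noteq> 0"
  proof
    assume "integral {\<sigma>..\<tau>} (\<lambda>\<theta>. (norm (w \<theta>))\<^sup>2) = 0"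
    then have 0: "w \<theta> = 0" if "\<theta> \<in> {\<sigma>..\<tau>}" for \<theta>
      using integral_eq_0_iff[OF cont \<open>\<sigma> < \<tau>\<close>] that by auto
    \<comment> \<open>With base point \<open>\<sigma>\<close> the solution at \<open>\<tau>\<close>
      reduces to a nonzero multiple of \<open>w' \<sigma>\<close>, because sinh vanishes only at
      0.\<close>
    have "w' \<sigma> = 0"
      using solution(1)[of \<sigma> \<tau>] 0[of \<sigma>] 0[of \<tau>] assms rate(1) by auto
    then show False
      using energy[of \<sigma>] 0[of \<sigma>] assms m_pos by auto
  qed
  moreover have "integral {\<sigma>..\<tau>} (\<lambda>\<theta>. (norm (w \<theta>))\<^sup>2) \<ge> 0"
    by (intro integral_nonneg integrable_continuous_real cont) auto
  ultimately show ?thesis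
    using eq by linarith
qed

lemma clock_le: "0 \<le> \<sigma> \<Longrightarrow> \<sigma> \<le> \<tau> \<Longrightarrow> \<tau> \<le> S \<Longrightarrow> clock \<sigma> \<le> clock \<tau>"
  using clock_less[of \<sigma> \<tau>] by (cases "\<sigma> = \<tau>") auto

lemma clock_image: "clock ` {0..S} = {0..T}"
proof
  show "clock ` {0..S} \<subseteq> {0..T}"
    using clock_le[of 0] clock_le[of _ S] by auto
  have "continuous_on {0..S} clock"
    by (rule continuous_on_vector_derivative[OF clock_derivative])
  then show "{0..T} \<subseteq> clock ` {0..S}"
    using IVT'[of clock 0 _ S] S_pos by fastforce
qed

text \<open>Both sides are the derivative of \<open>z (clock \<tau>)\<close>, by the chain rule and
  through the square of \<open>w\<close>. The factor is not divided out because it is zero at a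
  collision.\<close>

lemma velocity:
  assumes "\<tau> \<in> {0..S}" and "(z has_vector_derivative d) (at (clock \<tau>) within {0..T})"
  shows "(norm (w \<tau>))\<^sup>2 *\<^sub>R d = 2 * w \<tau> * w' \<tau>"
proof (rule has_vector_derivative_unique_Icc[OF S_pos assms(1)])
  have "((z \<circ> clock) has_vector_derivative (norm (w \<tau>))\<^sup>2 *\<^sub>R d) (at \<tau> within {0..S})"
    by (rule vector_diff_chain_within[OF clock_derivative])
      (use assms clock_image in auto)
  then show "((\<lambda>\<tau>. (w \<tau>)\<^sup>2) has_vector_derivative (norm (w \<tau>))\<^sup>2 *\<^sub>R d) (at \<tau> within {0..S})"
    by (rule has_vector_derivative_transform[rotated 2]) (use assms z_clock in auto)
  show "((\<lambda>\<tau>. (w \<tau>)\<^sup>2) has_vector_derivative 2 * w \<tau> * w' \<tau>) (at \<tau> within {0..S})"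
    unfolding power2_eq_square
    by (rule derivative_eq_intros w[OF assms(1)] refl)+ (simp add: algebra_simps)
qed

lemma reversed: "levi_civita H m T (\<lambda>s. z (T - s)) S (\<lambda>\<tau>. w (S - \<tau>)) (\<lambda>\<tau>. - w' (S - \<tau>))"
proof -
  let ?c = "\<lambda>\<tau>. integral {0..\<tau>} (\<lambda>\<theta>. (norm (w (S - \<theta>)))\<^sup>2)"
  have dw: "((\<lambda>\<tau>. w (S - \<tau>)) has_vector_derivative - w' (S - \<tau>)) (at \<tau> within {0..S})"
    if "\<tau> \<in> {0..S}" for \<tau>
    using that by (intro has_vector_derivative_reflect w) auto
  have dw': "((\<lambda>\<tau>. - w' (S - \<tau>)) has_vector_derivative (H / 2) *\<^sub>R w (S - \<tau>)) (at \<tau> within {0..S})"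
    if "\<tau> \<in> {0..S}" for \<tau>
    using that has_vector_derivative_minus[OF has_vector_derivative_reflect[OF w'[of "S - \<tau>"]]]
    by auto
  have c: "?c \<tau> = T - clock (S - \<tau>)" if "\<tau> \<in> {0..S}" for \<tau>
  proof -
    have "continuous_on {0..S} (\<lambda>\<tau>. w (S - \<tau>))"
      by (rule continuous_on_vector_derivative[OF dw])
    then have "continuous_on {0..S} (\<lambda>\<tau>. (norm (w (S - \<tau>)))\<^sup>2)"
      by (intro continuous_intros)
    then have 1: "(?c has_vector_derivative (norm (w (S - t)))\<^sup>2) (at t within {0..S})"
      if "t \<in> {0..S}" for t
      using integral_has_vector_derivative that by blast
    have 2: "((\<lambda>t. clock (S - t)) has_vector_derivative - ((norm (w (S - t)))\<^sup>2)) (at t within {0..S})"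
      if "t \<in> {0..S}" for t
      using that by (intro has_vector_derivative_reflect clock_derivative) auto
    \<comment> \<open>The clock of the reversed motion runs as fast as the original one runs
      backwards, so the sum keeps its initial value \<open>T\<close>.\<close>
    have "?c \<tau> + clock (S - \<tau>) = ?c 0 + clock (S - 0)"
      by (rule constant_on_Icc[where a = 0 and b = S and f = "\<lambda>t. ?c t + clock (S - t)"])
        (use that has_vector_derivative_add[OF 1 2] in auto)
    then show ?thesis
      by simp
  qed
  show ?thesis
  proof
    show "z (T - ?c \<tau>) = (w (S - \<tau>))\<^sup>2" if "\<tau> \<in> {0..S}" for \<tau>
      unfolding c[OF that] using that z_clock[of "S - \<tau>"] by simp
    show "T = ?c S"
      using c[of S] S_pos by simp
  qed (use H_pos m_pos S_pos dw dw' energy in auto)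
qed

text \<open>A motion through the origin runs along a ray with \<open>|z|\<close> proportional to
  \<open>sinh\<^sup>2 (rate (\<tau> - \<tau>\<^sub>0))\<close>, so it retraces itself after the collision. If the two
  endpoints differed, the motion would pass through one of them in between.\<close>

lemma collision_ejection:
  assumes collision: "s \<in> {0..T}" "z s = 0"
    and "z 0 \<notin> U" "z T \<notin> U" "0 \<in> U" and inside: "\<And>s. s \<in> {0<..<T} \<Longrightarrow> z s \<in> U"
    and d: "(z has_vector_derivative d) (at 0 within {0..T})"
    and e: "(z has_vector_derivative e) (at T within {0..T})"
  shows "z T = z 0 \<and> e = - d"
proof -
  obtain a where a: "a \<in> {0..S}" "clock a = s"
    using collision(1) unfolding clock_image[symmetric] by blast
  then have "w a = 0"
    using z_clock[of a] collision(2) by auto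
  \<comment> \<open>Taking the collision as base point leaves only the terms in \<open>w' a\<close>:
    \<open>w\<close> is odd and \<open>w'\<close> is even about \<open>a\<close>.\<close>
  then have w_eq: "w \<tau> = (sinh (rate * (\<tau> - a)) / rate) *\<^sub>R w' a"
    and w'_eq: "w' \<tau> = cosh (rate * (\<tau> - a)) *\<^sub>R w' a" if "\<tau> \<in> {0..S}" for \<tau>
    using solution[OF a(1) that] by auto
  have in_U: "(w \<tau>)\<^sup>2 \<in> U" if "0 < \<tau>" "\<tau> < S" for \<tau>
    using inside[of "clock \<tau>"] z_clock[of \<tau>] clock_less[of 0 \<tau>] clock_less[of \<tau> S] that by auto
  have z0: "z 0 = (w 0)\<^sup>2" and zT: "z T = (w S)\<^sup>2"
    using z_clock[of 0] z_clock[of S] S_pos by auto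
  have refl: "w (2 * a - \<tau>) = - w \<tau>" if "\<tau> \<in> {0..S}" "2 * a - \<tau> \<in> {0..S}" for \<tau>
  proof -
    have "rate * ((2 * a - \<tau>) - a) = - (rate * (\<tau> - a))"
      by (simp add: algebra_simps)
    then have "sinh (rate * ((2 * a - \<tau>) - a)) = - sinh (rate * (\<tau> - a))"
      by (simp only: sinh_minus)
    then show ?thesis
      unfolding w_eq[OF that(1)] w_eq[OF that(2)] by simp
  qed
  have "z 0 \<noteq> 0" "z T \<noteq> 0"
    using assms by auto
  then have "a \<noteq> 0" "a \<noteq> S"
    using \<open>w a = 0\<close> z0 zT by auto
  \<comment> \<open>If the collision came before the midpoint, then at the interior time
    \<open>2 * a\<close> the motion would be back at \<open>z 0\<close>, outside \<open>U\<close>.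
    If it came after, \<open>2 * a - S\<close> would be an interior time at the position
    \<open>z T\<close>.\<close>
  have "2 * a = S"
  proof (rule ccontr)
    assume "2 * a \<noteq> S"
    then consider "2 * a < S" | "2 * a > S"
      by linarith
    then show False
    proof cases
      case 1
      then show False
        using in_U[of "2 * a"] refl[of 0] a \<open>a \<noteq> 0\<close> z0 assms(3) by auto
    next
      case 2
      then show False
        using in_U[of "2 * a - S"] refl[of S] a \<open>a \<noteq> S\<close> zT assms(4) by auto
    qed
  qed
  then have wS: "w S = - w 0"
    using refl[of 0] S_pos by auto
  have "rate * (S - a) = - (rate * (0 - a))"
    using \<open>2 * a = S\<close> by (simp add: algebra_simps)
  then have "cosh (rate * (S - a)) = cosh (rate * (0 - a))"
    by (simp only: cosh_minus)
  then have w'S: "w' S = w' 0"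
    using w'_eq[of S] w'_eq[of 0] S_pos by simp
  \<comment> \<open>From one end to the other \<open>w\<close> changes sign and \<open>w'\<close>
    does not, so their product changes sign and with it the velocity.\<close>
  have "(norm (w S))\<^sup>2 *\<^sub>R e = 2 * w S * w' S" "(norm (w 0))\<^sup>2 *\<^sub>R d = 2 * w 0 * w' 0"
    using velocity[of S e] velocity[of 0 d] d e S_pos by auto
  then have "(norm (w 0))\<^sup>2 *\<^sub>R (e + d) = 0"
    by (simp add: wS w'S scaleR_add_right)
  then have "e = - d"
    using \<open>z 0 \<noteq> 0\<close> z0 by (auto simp: eq_neg_iff_add_eq_0)
  then show ?thesis
    using z0 zT wS by simp
qed

end

text \<open>The lift of a motion through the squaring map is determined up to sign.\<close>

lemma levi_civita_agree:
  assumes "levi_civita H m T z S w w'" and "levi_civita H m T\<^sub>2 z\<^sub>2 S\<^sub>2 w\<^sub>2 w\<^sub>2'"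
    and "z 0 = z\<^sub>2 0" "z 0 \<noteq> 0"
    and "(z has_vector_derivative d) (at 0 within {0..T})"
    and "(z\<^sub>2 has_vector_derivative d) (at 0 within {0..T\<^sub>2})"
    and "S \<le> S\<^sub>2"
  shows "T \<le> T\<^sub>2" and "s \<in> {0..T} \<Longrightarrow> z\<^sub>2 s = z s"
proof -
  interpret L1: levi_civita H m T z S w w' by fact
  interpret L2: levi_civita H m T\<^sub>2 z\<^sub>2 S\<^sub>2 w\<^sub>2 w\<^sub>2' by fact
  have w0: "(w 0)\<^sup>2 = z 0" "(w\<^sub>2 0)\<^sup>2 = z 0"
    using L1.z_clock[of 0] L2.z_clock[of 0] L1.S_pos L2.S_pos assms(3) by auto
  \<comment> \<open>The sign \<open>e\<close> is the choice of square root at time 0; linearity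
    carries it along the whole lift, and squaring removes it.\<close>
  then obtain e :: real where e: "e = 1 \<or> e = - 1" "w\<^sub>2 0 = e *\<^sub>R w 0"
    by (metis power2_eq_iff scaleR_minus1_left scaleR_one)
  have "w 0 \<noteq> 0"
    using w0 assms(4) by auto
  have "(norm (w 0))\<^sup>2 *\<^sub>R d = 2 * w 0 * w' 0" "(norm (w\<^sub>2 0))\<^sup>2 *\<^sub>R d = 2 * w\<^sub>2 0 * w\<^sub>2' 0"
    using L1.velocity[of 0 d] L2.velocity[of 0 d] assms(5,6) L1.S_pos L2.S_pos by auto
  then have "w 0 * (w\<^sub>2' 0 - e *\<^sub>R w' 0) = 0"
    using e by (auto simp: algebra_simps)
  then have e': "w\<^sub>2' 0 = e *\<^sub>R w' 0"
    using \<open>w 0 \<noteq> 0\<close> by simp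
  have w2: "w\<^sub>2 \<tau> = e *\<^sub>R w \<tau>" if "\<tau> \<in> {0..S}" for \<tau>
    using L1.solution(1)[of 0 \<tau>] L2.solution(1)[of 0 \<tau>] that \<open>S \<le> S\<^sub>2\<close> e(2) e'
    by (simp add: algebra_simps)
  have clock: "L2.clock \<tau> = L1.clock \<tau>" if "\<tau> \<in> {0..S}" for \<tau>
    unfolding L1.clock_def L2.clock_def using w2 that e(1)
    by (intro integral_cong) auto
  have "L2.clock S \<le> L2.clock S\<^sub>2"
    using L2.clock_le[of S S\<^sub>2] L1.S_pos \<open>S \<le> S\<^sub>2\<close> by simp
  then show "T \<le> T\<^sub>2"
    using clock[of S] L1.S_pos by simp
  show "z\<^sub>2 s = z s" if "s \<in> {0..T}"
  proof -
    obtain \<tau> where \<tau>: "\<tau> \<in> {0..S}" "L1.clock \<tau> = s"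
      using \<open>s \<in> {0..T}\<close> unfolding L1.clock_image[symmetric] by blast
    have "z\<^sub>2 s = (w\<^sub>2 \<tau>)\<^sup>2"
      using L2.z_clock[of \<tau>] clock[OF \<tau>(1)] \<tau> \<open>S \<le> S\<^sub>2\<close> by auto
    also have "\<dots> = (w \<tau>)\<^sup>2"
      using w2[OF \<tau>(1)] e(1) by auto
    finally show ?thesis
      using L1.z_clock[of \<tau>] \<tau> by auto
  qed
qed

subsection \<open>Reversal and uniqueness of the legs\<close>

text \<open>The involution that realizes time reversal on boundary states; it exchanges arrivals and
  departures.\<close>

definition flip :: "state \<Rightarrow> state" where
  "flip x = (fst x, - snd x)"

lemma fst_flip [simp]: "fst (flip x) = fst x"
  and snd_flip [simp]: "snd (flip x) = - snd x"
  and flip_flip [simp]: "flip (flip x) = x"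
  and flip_eq_iff [simp]: "flip x = flip y \<longleftrightarrow> x = y"
  by (auto simp: flip_def prod_eq_iff)

lemma flip_Xi_in [simp]: "flip x \<in> Xi_in B A r \<longleftrightarrow> x \<in> Xi_out B A r"
  and flip_Xi_out [simp]: "flip x \<in> Xi_out B A r \<longleftrightarrow> x \<in> Xi_in B A r"
  by (auto simp: flip_def Xi_in_def Xi_out_def split: prod.splits)

lemma refract_flip: "refract B h (flip x) = - refract B h x"
  by (cases x) (simp add: flip_def refract_def Let_def sgn_minus)

text \<open>The force depends on position alone and the energy on speed, so the two sign changes of
  the second derivative cancel.\<close>

lemma motion_reversed:
  assumes "motion f V T z"
  shows "motion f V T (\<lambda>s. z (T - s))"
proof -
  obtain v where v: "\<And>s. s \<in> {0..T} \<Longrightarrow> (z has_vector_derivative v s) (at s within {0..T}) \<and>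
      (v has_vector_derivative f (z s)) (at s within {0..T}) \<and> (norm (v s))\<^sup>2 / 2 = V (z s)"
    using assms unfolding motion_def by blast
  show ?thesis
    unfolding motion_def
  proof (intro exI[of _ "\<lambda>s. - v (T - s)"] ballI conjI)
    fix s assume "s \<in> {0..T}"
    then have s: "T - s \<in> {0..T}"
      by auto
    show "((\<lambda>s. z (T - s)) has_vector_derivative - v (T - s)) (at s within {0..T})"
      using v[OF s] by (intro has_vector_derivative_reflect) blast
    have "((\<lambda>s. v (T - s)) has_vector_derivative - f (z (T - s))) (at s within {0..T})"
      using v[OF s] by (intro has_vector_derivative_reflect) blast
    then show "((\<lambda>s. - v (T - s)) has_vector_derivative f (z (T - s))) (at s within {0..T})"
      using has_vector_derivative_minus by fastforce
    show "(norm (- v (T - s)))\<^sup>2 / 2 = V (z (T - s))"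
      using v[OF s] by simp
  qed
qed

lemma outer_leg_flip:
  assumes "outer_leg B x p"
  shows "outer_leg B (flip p) (flip x)"
proof -
  obtain T z where *: "T > 0" "outer_motion B T z" "\<forall>s\<in>{0<..<T}. z s \<notin> closure (region B)"
      "z 0 = bdry B (fst x)" "(z has_vector_derivative snd x) (at 0 within {0..T})"
      "z T = bdry B (fst p)" "(z has_vector_derivative snd p) (at T within {0..T})"
    using assms unfolding outer_leg_def by blast
  show ?thesis
    unfolding outer_leg_def
  proof (intro exI[of _ T] exI[of _ "\<lambda>s. z (T - s)"] conjI)
    show "outer_motion B T (\<lambda>s. z (T - s))"
      using * motion_reversed unfolding outer_motion_def by blast
    show "((\<lambda>s. z (T - s)) has_vector_derivative snd (flip p)) (at 0 within {0..T})"
      using has_vector_derivative_reflect[of z "snd p" T 0] * by simp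
    show "((\<lambda>s. z (T - s)) has_vector_derivative snd (flip x)) (at T within {0..T})"
      using has_vector_derivative_reflect[of z "snd x" T T] * by simp
  qed (use * in auto)
qed

text \<open>The locale predicate adds only the positivity of \<open>H\<close> and \<open>m\<close>
  to the conditions on \<open>S\<close>, \<open>w\<close> and \<open>w'\<close>.\<close>

lemma regularized_motion_iff:
  assumes "energy B + h > 0" "mu B > 0"
  shows "regularized_motion B h T z \<longleftrightarrow>
    (\<exists>S w w'. levi_civita (energy B + h) (mu B) T z S w w')"
  unfolding regularized_motion_def levi_civita_def
  by (intro ex_cong1) (use assms in blast)

section \<open>Boundary geometry, Snell refraction and outer legs\<close>

locale refraction =
  fixes B :: billiard
  assumes domain: "refraction_domain B"
begin

lemma positive: "omega B > 0" "mu B > 0" "energy B > 0" "bdry_len B > 0"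
  using domain by (auto simp: refraction_domain_def)

lemma bdry_in_frontier:
  assumes "\<xi> \<in> {0..bdry_len B}"
  shows "bdry B \<xi> \<in> closure (region B)" "bdry B \<xi> \<notin> region B"
proof -
  have "open (region B)" "bdry B \<xi> \<in> frontier (region B)"
    using domain assms by (auto simp: refraction_domain_def)
  then show "bdry B \<xi> \<in> closure (region B)" "bdry B \<xi> \<notin> region B"
    by (auto simp: frontier_def interior_open)
qed

lemma origin_in_region: "0 \<in> region B"
  using domain by (auto simp: refraction_domain_def)

lemma bdry_nonzero: "\<xi> \<in> {0..bdry_len B} \<Longrightarrow> bdry B \<xi> \<noteq> 0"
  using bdry_in_frontier(2) origin_in_region by metis

text \<open>Open parameter intervals exclude the point where the closed curve meets itself, namely 0
  and \<open>bdry_len B\<close>.\<close>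

lemma bdry_eq_iff:
  "\<xi> \<in> {0<..<bdry_len B} \<Longrightarrow> \<eta> \<in> {0<..<bdry_len B} \<Longrightarrow> bdry B \<xi> = bdry B \<eta> \<longleftrightarrow> \<xi> = \<eta>"
  using domain by (auto simp: refraction_domain_def inj_on_def)

lemma norm_tangent:
  assumes "\<xi> \<in> {0..bdry_len B}"
  shows "norm (tangent B \<xi>) = 1"
proof -
  obtain t where t: "norm (t \<xi>) = 1"
      "(bdry B has_vector_derivative t \<xi>) (at \<xi> within {0..bdry_len B})"
    using domain assms unfolding refraction_domain_def by blast
  then have "tangent B \<xi> = t \<xi>"
    unfolding tangent_def
    using vector_derivative_within_cbox[of 0 "bdry_len B" \<xi>] positive(4) assms by simp
  then show ?thesis
    using t by simp
qed

lemma normal_out_cases: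
  "normal_out B \<xi> = - \<i> * tangent B \<xi> \<or> normal_out B \<xi> = \<i> * tangent B \<xi>"
  by (simp add: normal_out_def Let_def)

text \<open>Either candidate for the normal is the unit tangent turned by a right angle, so both
  cases reduce to the same computation in coordinates.\<close>

lemma frame:
  assumes "\<xi> \<in> {0..bdry_len B}"
  shows "tangent B \<xi> \<bullet> tangent B \<xi> = 1" "normal_out B \<xi> \<bullet> normal_out B \<xi> = 1"
    "tangent B \<xi> \<bullet> normal_out B \<xi> = 0"
    "v = (v \<bullet> tangent B \<xi>) *\<^sub>R tangent B \<xi> + (v \<bullet> normal_out B \<xi>) *\<^sub>R normal_out B \<xi>"
proof -
  obtain x y where t: "tangent B \<xi> = Complex x y"
    by (cases "tangent B \<xi>")
  then have xy: "x * x + y * y = 1"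
    using norm_tangent[OF assms] by (simp add: cmod_def power2_eq_square)
  show "tangent B \<xi> \<bullet> tangent B \<xi> = 1" "normal_out B \<xi> \<bullet> normal_out B \<xi> = 1"
    "tangent B \<xi> \<bullet> normal_out B \<xi> = 0"
    using normal_out_cases[of \<xi>] xy by (auto simp: t inner_complex_def)
  obtain a b where v: "v = Complex a b"
    by (cases v)
  have "a = a * (x * x + y * y)" "b = b * (x * x + y * y)"
    by (simp_all add: xy)
  then show "v = (v \<bullet> tangent B \<xi>) *\<^sub>R tangent B \<xi> + (v \<bullet> normal_out B \<xi>) *\<^sub>R normal_out B \<xi>"
    using normal_out_cases[of \<xi>]
    by (auto simp: t v inner_complex_def complex_eq_iff algebra_simps)
qed

text \<open>Refraction preserves the tangential component, and on the energy surface the normal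
  component is then determined up to its sign.\<close>

lemma refract_inj:
  assumes "fst x \<in> {0..bdry_len B}" and "x \<in> Xi_out B A r" "y \<in> Xi_out B A r'"
    and "fst x = fst y" "refract B h x = refract B h y"
  shows "x = y"
proof -
  define \<xi> v u where "\<xi> = fst x" and "v = snd x" and "u = snd y"
  then have xy: "x = (\<xi>, v)" "y = (\<xi>, u)"
    using assms(4) by (auto simp: prod_eq_iff)
  note assms = assms[unfolded xy fst_conv]
  note f = frame[OF assms(1)]
  have tangential: "refract B h (\<xi>, v) \<bullet> tangent B \<xi> = v \<bullet> tangent B \<xi>" for v
    by (simp add: refract_def Let_def inner_add_left f inner_commute[of "normal_out B \<xi>"])
  have t: "v \<bullet> tangent B \<xi> = u \<bullet> tangent B \<xi>"
    using tangential[of v] tangential[of u] assms(5) by simp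
  have pythagoras: "(norm v)\<^sup>2 = (v \<bullet> tangent B \<xi>)\<^sup>2 + (v \<bullet> normal_out B \<xi>)\<^sup>2" for v
  proof -
    have "(norm v)\<^sup>2 = v \<bullet> ((v \<bullet> tangent B \<xi>) *\<^sub>R tangent B \<xi> +
        (v \<bullet> normal_out B \<xi>) *\<^sub>R normal_out B \<xi>)"
      using f(4)[of v] by (simp add: power2_norm_eq_inner)
    then show ?thesis
      by (simp add: inner_add_right power2_eq_square)
  qed
  have "(v \<bullet> normal_out B \<xi>)\<^sup>2 = (u \<bullet> normal_out B \<xi>)\<^sup>2"
    using pythagoras[of v] pythagoras[of u] t assms(2,3) by (auto simp: Xi_out_def)
  \<comment> \<open>Both states are outgoing, so both normal components are positive and equal
    squares suffice.\<close>
  then have "v \<bullet> normal_out B \<xi> = u \<bullet> normal_out B \<xi>"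
    by (rule power2_eq_imp_eq) (use assms(2,3) in \<open>auto simp: Xi_out_def inner_commute\<close>)
  then have "v = u"
    using f(4)[of v] f(4)[of u] t by simp
  then show ?thesis
    by (simp add: xy)
qed

text \<open>Two legs with the same start agree as long as both last. If one were shorter, its end
  would be a boundary point at which the longer one is still outside the closure of the
  domain.\<close>

lemma outer_leg_unique:
  assumes "outer_leg B x p\<^sub>1" "outer_leg B x p\<^sub>2"
    and "fst p\<^sub>1 \<in> {0<..<bdry_len B}" "fst p\<^sub>2 \<in> {0<..<bdry_len B}"
  shows "p\<^sub>1 = p\<^sub>2"
proof -
  \<comment> \<open>Naming the velocity \<open>v\<close> on the whole interval turns the two end
    conditions on the derivative into values of \<open>v\<close>.\<close>
  define leg where "leg p T z v \<longleftrightarrow> T > 0 \<and>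
      (\<forall>s\<in>{0..T}. (z has_vector_derivative v s) (at s within {0..T}) \<and>
        (v has_vector_derivative - ((omega B)\<^sup>2 *\<^sub>R z s)) (at s within {0..T})) \<and>
      (\<forall>s\<in>{0<..<T}. z s \<notin> closure (region B)) \<and>
      z 0 = bdry B (fst x) \<and> v 0 = snd x \<and> z T = bdry B (fst p) \<and> v T = snd p" for p T z v
  have leg: "\<exists>T z v. leg p T z v" if outer: "outer_leg B x p" for p
  proof -
    obtain T z where *: "T > 0" "outer_motion B T z" "\<forall>s\<in>{0<..<T}. z s \<notin> closure (region B)"
        "z 0 = bdry B (fst x)" "(z has_vector_derivative snd x) (at 0 within {0..T})"
        "z T = bdry B (fst p)" "(z has_vector_derivative snd p) (at T within {0..T})"
      using outer unfolding outer_leg_def by blast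
    obtain v where v: "\<forall>s\<in>{0..T}. (z has_vector_derivative v s) (at s within {0..T}) \<and>
        (v has_vector_derivative - ((omega B)\<^sup>2 *\<^sub>R z s)) (at s within {0..T})"
      using *(2) unfolding outer_motion_def motion_def by blast
    have "v 0 = snd x" "v T = snd p"
      using v * has_vector_derivative_unique_Icc[OF \<open>T > 0\<close>, of _ z]
      by (meson atLeastAtMost_iff less_imp_le order.refl)+
    with * v show ?thesis
      unfolding leg_def by blast
  qed
  have main: "p = q \<or> fst p \<notin> {0<..<bdry_len B} \<or> fst q \<notin> {0<..<bdry_len B}"
    if p: "leg p T z v" and q: "leg q T' z' v'" and "T \<le> T'" for p q T T' z z' v v'
  proof -
    have agree: "z s = z' s \<and> v s = v' s" if "s \<in> {0..T}" for s
    proof (rule harmonic_oscillator_unique[where k = "(omega B)\<^sup>2" and T = T])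
      show "(omega B)\<^sup>2 > 0"
        using positive by simp
      fix s assume "s \<in> {0..T}"
      then show "(z' has_vector_derivative v' s) (at s within {0..T}) \<and>
          (v' has_vector_derivative - ((omega B)\<^sup>2 *\<^sub>R z' s)) (at s within {0..T})"
        using q \<open>T \<le> T'\<close> unfolding leg_def
        by (auto intro: has_vector_derivative_within_subset[where S = "{0..T'}"])
    qed (use p q that in \<open>auto simp: leg_def\<close>)
    show ?thesis
    proof (cases "T = T'")
      case True
      then show ?thesis
        using agree[of T] p q bdry_eq_iff by (auto simp: leg_def prod_eq_iff)
    next
      case False
      then have "bdry B (fst p) \<notin> closure (region B)"
        using agree[of T] p q \<open>T \<le> T'\<close> by (auto simp: leg_def)
      then show ?thesis
        using bdry_in_frontier(1)[of "fst p"] by auto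
    qed
  qed
  obtain T z v T' z' v' where "leg p\<^sub>1 T z v" "leg p\<^sub>2 T' z' v'"
    using leg assms(1,2) by meson
  then show ?thesis
    using main[of p\<^sub>1 T z v p\<^sub>2 T' z' v'] main[of p\<^sub>2 T' z' v' p\<^sub>1 T z v] assms(3,4)
    by (cases "T \<le> T'") auto
qed

end

section \<open>Inner legs and their collisions\<close>

locale refraction_system = refraction +
  fixes h :: real
  assumes h_pos: "h > 0"
begin

lemma total_energy_pos: "energy B + h > 0"
  using positive h_pos by simp

lemmas regularized_motion_lift = regularized_motion_iff[OF total_energy_pos positive(2)]

lemma regularized_motionE:
  assumes "regularized_motion B h T z"
  obtains S w w' where "levi_civita (energy B + h) (mu B) T z S w w'"
  using assms unfolding regularized_motion_lift by blast

lemma inner_leg_flip: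
  assumes "inner_leg B h p y T z"
  shows "inner_leg B h (flip y) (flip p) T (\<lambda>s. z (T - s))"
  unfolding inner_leg_def
proof (intro conjI)
  note * = assms[unfolded inner_leg_def]
  obtain S w w' where "levi_civita (energy B + h) (mu B) T z S w w'"
    using * regularized_motionE by blast
  then show "regularized_motion B h T (\<lambda>s. z (T - s))"
    unfolding regularized_motion_lift using levi_civita.reversed by blast
  show "((\<lambda>s. z (T - s)) has_vector_derivative refract B h (flip y)) (at 0 within {0..T})"
    using has_vector_derivative_reflect[of z "refract B h y" T 0] * by (simp add: refract_flip)
  show "((\<lambda>s. z (T - s)) has_vector_derivative refract B h (flip p)) (at T within {0..T})"
    using has_vector_derivative_reflect[of z "refract B h p" T T] * by (simp add: refract_flip)
qed (use assms in \<open>auto simp: inner_leg_def\<close>)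

text \<open>The lifts are compared in fictitious time, so collisions do not interfere. A leg that
  ended earlier would put a boundary point inside the open domain; once the durations agree,
  injectivity of refraction recovers the state.\<close>

lemma inner_leg_unique:
  assumes "inner_leg B h p y\<^sub>1 T\<^sub>1 z\<^sub>1" "inner_leg B h p y\<^sub>2 T\<^sub>2 z\<^sub>2"
    and "y\<^sub>1 \<in> Xi_out B A r\<^sub>1" "y\<^sub>2 \<in> Xi_out B A r\<^sub>2"
    and "fst p \<in> {0<..<bdry_len B}"
    and "fst y\<^sub>1 \<in> {0<..<bdry_len B}" "fst y\<^sub>2 \<in> {0<..<bdry_len B}"
  shows "y\<^sub>1 = y\<^sub>2"
proof -
  have main: "y = y'"
    if y: "inner_leg B h p y T z" "y \<in> Xi_out B A r" "fst y \<in> {0<..<bdry_len B}"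
      "levi_civita (energy B + h) (mu B) T z S w w'"
    and y': "inner_leg B h p y' T' z'" "y' \<in> Xi_out B A r'" "fst y' \<in> {0<..<bdry_len B}"
      "levi_civita (energy B + h) (mu B) T' z' S' v v'"
    and "S \<le> S'" for y y' T T' z z' S S' w w' v v' r r'
  proof -
    have z0: "z 0 = z' 0" "z 0 \<noteq> 0"
      using y(1) y'(1) bdry_nonzero[of "fst p"] assms(5) by (auto simp: inner_leg_def)
    have "T \<le> T'" and agree: "\<And>s. s \<in> {0..T} \<Longrightarrow> z' s = z s"
      using levi_civita_agree[OF y(4) y'(4) z0 _ _ \<open>S \<le> S'\<close>] y(1) y'(1)
      by (auto simp: inner_leg_def)
    have "T = T'"
    proof (rule ccontr)
      assume "T \<noteq> T'"
      then have "z' T \<in> region B"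
        using \<open>T \<le> T'\<close> y(1) y'(1) by (simp add: inner_leg_def)
      then have "bdry B (fst y) \<in> region B"
        using agree[of T] y(1) by (simp add: inner_leg_def)
      then show False
        using bdry_in_frontier(2)[of "fst y"] y(3) by auto
    qed
    then have "bdry B (fst y) = bdry B (fst y')"
      using agree[of T] y(1) y'(1) by (auto simp: inner_leg_def)
    then have \<xi>: "fst y = fst y'"
      using bdry_eq_iff y(3) y'(3) by blast
    have "(z has_vector_derivative refract B h y') (at T within {0..T})"
      by (rule has_vector_derivative_transform[where f = z'])
        (use agree y(1) y'(1) \<open>T = T'\<close> in \<open>auto simp: inner_leg_def\<close>)
    then have "refract B h y = refract B h y'"
      using has_vector_derivative_unique_Icc[of 0 T T z] y(1) by (auto simp: inner_leg_def)
    then show "y = y'"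
      using refract_inj[of y A r y' r' h] y(2,3) y'(2) \<xi> by simp
  qed
  obtain S w w' S' v v' where
    "levi_civita (energy B + h) (mu B) T\<^sub>1 z\<^sub>1 S w w'"
    "levi_civita (energy B + h) (mu B) T\<^sub>2 z\<^sub>2 S' v v'"
    using assms(1,2) regularized_motionE unfolding inner_leg_def by metis
  then show ?thesis
    using main[OF assms(1,3,6) _ assms(2,4,7)] main[OF assms(2,4,7) _ assms(1,3,6)]
    by (cases "S \<le> S'") auto
qed

text \<open>Collision-ejection reverses the refracted velocity. Since refraction commutes with
  \<open>flip\<close> and \<open>flip p\<close> is outgoing, injectivity of refraction transfers
  this to the states themselves.\<close>

lemma collisional_inner_leg:
  assumes leg: "inner_leg B h p y T z" and "collisional T z"
    and "p \<in> Xi_in B A r" "y \<in> Xi_out B A r'"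
    and p: "fst p \<in> {0<..<bdry_len B}" and y: "fst y \<in> {0<..<bdry_len B}"
  shows "y = flip p"
proof -
  note * = leg[unfolded inner_leg_def]
  obtain S w w' where "levi_civita (energy B + h) (mu B) T z S w w'"
    using * regularized_motionE by blast
  then interpret levi_civita "energy B + h" "mu B" T z S w w' .
  obtain s where s: "s \<in> {0..T}" "z s = 0"
    using assms(2) by (auto simp: collisional_def)
  have "z 0 \<notin> region B" "z T \<notin> region B"
    using * p y bdry_in_frontier(2)[of "fst p"] bdry_in_frontier(2)[of "fst y"] by simp_all
  then have "z T = z 0 \<and> refract B h y = - refract B h p"
    using * by (intro collision_ejection[OF s _ _ origin_in_region]) simp_all
  then have \<xi>: "fst y = fst p" and "refract B h y = refract B h (flip p)"
    using * bdry_eq_iff[OF y p] by (auto simp: refract_flip)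
  then show ?thesis
    using refract_inj[of y A r' "flip p" r h] assms(3,4) y by simp
qed

end

subsection \<open>The return map\<close>

locale refraction_dynamics = refraction_system +
  fixes A :: arc_family
  assumes family: "admissible_family B A"
begin

lemma cpt_subset_opn: "r \<in> indices A \<Longrightarrow> cpt A r \<subseteq> opn A r"
  using family unfolding admissible_family_def change_sign_property_def cpt_def opn_def by auto

text \<open>This keeps all symbols away from the closing point of the boundary curve, so that
  parameters can be read off positions.\<close>

lemma cpt_interior:
  assumes "r \<in> indices A" "\<xi> \<in> cpt A r"
  shows "\<xi> \<in> {0<..<bdry_len B}"
proof -
  have "opn A r \<subseteq> {0..bdry_len B}" "lo A r < hi A r"
    using family assms(1)
    unfolding admissible_family_def inner_arc_property_def IP0_def by auto
  then have "0 \<le> lo A r" "hi A r \<le> bdry_len B"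
    unfolding opn_def greaterThanLessThan_subseteq_atLeastAtMost_iff by auto
  then show ?thesis
    using cpt_subset_opn[OF assms(1)] assms(2) by (auto simp: opn_def)
qed

lemma cpt_disjoint:
  assumes "r \<in> indices A" "r' \<in> indices A" "\<xi> \<in> cpt A r" "\<xi> \<in> cpt A r'"
  shows "r = r'"
proof -
  have "r \<noteq> r' \<longrightarrow> opn A r \<inter> opn A r' = {}"
    using family assms(1,2)
    unfolding admissible_family_def inner_arc_property_def IP0_def by auto
  then show ?thesis
    using assms cpt_subset_opn by blast
qed

lemma symbol_eq: "r \<in> indices A \<Longrightarrow> fst x \<in> cpt A r \<Longrightarrow> symbol A x = r"
  unfolding symbol_def using cpt_disjoint by blast

text \<open>The two legs of a return, with \<open>p\<close> the state of arrival at the boundary from outside.\<close>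

definition legs :: "state \<Rightarrow> state \<Rightarrow> state \<Rightarrow> bool" where
  "legs x p y \<longleftrightarrow>
     symbol A x \<in> indices A \<and> symbol A y \<in> indices A \<and>
     x \<in> Xi_out B A (symbol A x) \<and> p \<in> Xi_in B A (symbol A x) \<and> y \<in> Xi_out B A (symbol A y) \<and>
     outer_leg B x p \<and> (\<exists>T z. inner_leg B h p y T z)"

lemma legs_interior:
  assumes "legs x p y"
  shows "fst x \<in> {0<..<bdry_len B}" "fst p \<in> {0<..<bdry_len B}" "fst y \<in> {0<..<bdry_len B}"
  using assms cpt_interior unfolding legs_def Xi_out_def Xi_in_def by auto

text \<open>An outer leg starts and arrives over the same interval. The mirror symmetry of words
  needs this, since retracing pairs states with arrivals.\<close>

lemma symbol_legs: "legs x p y \<Longrightarrow> symbol A p = symbol A x"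
  unfolding legs_def by (intro symbol_eq) (auto simp: Xi_in_def)

lemma return_step_legs:
  assumes "return_step B A h x y T z"
  obtains p where "legs x p y" "inner_leg B h p y T z"
proof -
  obtain r r' p where *: "r \<in> indices A" "r' \<in> NA B A r"
      "x \<in> Xi_out B A r" "p \<in> Xi_in B A r" "y \<in> Xi_out B A r'"
      "outer_leg B x p" "inner_leg B h p y T z"
    using assms unfolding return_step_def by blast
  then have "symbol A x = r" "symbol A y = r'" "r' \<in> indices A"
    by (auto simp: Xi_out_def NA_def intro!: symbol_eq)
  with * have "legs x p y"
    unfolding legs_def by blast
  with *(7) show thesis
    by (rule that[rotated])
qed

lemma outer_leg_legs_unique:
  assumes "legs x p y" "legs x q y'"
  shows "p = q"
  using outer_leg_unique[of x p q] assms legs_interior unfolding legs_def by blast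

lemma legs_unique:
  assumes "legs x p y" "legs x q y'"
  shows "y = y'"
proof -
  have "p = q"
    using assms by (rule outer_leg_legs_unique)
  then show ?thesis
    using inner_leg_unique[of p y _ _ y' _ _ A "symbol A y" "symbol A y'"]
      assms legs_interior[OF assms(1)] legs_interior[OF assms(2)] unfolding legs_def by blast
qed

text \<open>Backward determinism is forward determinism of the reversed legs, which all start from
  \<open>flip y\<close>.\<close>

lemma inner_leg_legs_back_unique:
  assumes "legs x p y" "legs x' q y"
  shows "p = q"
proof -
  obtain T z T' z' where "inner_leg B h (flip y) (flip p) T z" "inner_leg B h (flip y) (flip q) T' z'"
    using assms inner_leg_flip unfolding legs_def by blast
  then have "flip p = flip q"
    by (rule inner_leg_unique[where A = A and r\<^sub>1 = "symbol A x" and r\<^sub>2 = "symbol A x'"])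
      (use assms legs_interior[OF assms(1)] legs_interior[OF assms(2)] in \<open>simp_all add: legs_def\<close>)
  then show ?thesis
    by simp
qed

lemma legs_back_unique:
  assumes "legs x p y" "legs x' q y"
  shows "x = x'"
proof -
  have "p = q"
    using assms by (rule inner_leg_legs_back_unique)
  then have "outer_leg B (flip p) (flip x)" "outer_leg B (flip p) (flip x')"
    using assms outer_leg_flip unfolding legs_def by blast+
  then have "flip x = flip x'"
    by (rule outer_leg_unique) (use legs_interior[OF assms(1)] legs_interior[OF assms(2)] in simp_all)
  then show ?thesis
    by simp
qed

lemma return_map_eq: "return_step B A h x y T z \<Longrightarrow> return_map B A h x = y"
  unfolding return_map_def by (blast intro: the_equality legs_unique elim: return_step_legs)

lemma return_dom_step:
  assumes "x \<in> return_dom B A h"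
  obtains T z where "return_step B A h x (return_map B A h x) T z"
  using assms return_map_eq unfolding return_dom_def by blast

text \<open>Backward determinism of both legs; this makes \<open>return_inv\<close> a true inverse
  on the image.\<close>

lemma inj_on_return_map: "inj_on (return_map B A h) (return_dom B A h)"
proof (rule inj_onI)
  fix x x' assume "x \<in> return_dom B A h" "x' \<in> return_dom B A h"
    "return_map B A h x = return_map B A h x'"
  then show "x = x'"
    by (metis return_dom_step return_step_legs legs_back_unique)
qed

lemma return_inv_return_map:
  "x \<in> return_dom B A h \<Longrightarrow> return_inv B A h (return_map B A h x) = x"
  unfolding return_inv_def by (rule inv_into_f_f[OF inj_on_return_map])

section \<open>Bi-infinite orbits and equivariance of the coding\<close>

lemma return_iter_step:
  assumes "x \<in> invariant_set B A h"
  shows "return_iter B A h k x \<in> return_dom B A h \<and>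
    return_iter B A h (k + 1) x = return_map B A h (return_iter B A h k x)"
proof (cases "k \<ge> 0")
  case True
  then have "nat (k + 1) = Suc (nat k)"
    by simp
  with True assms show ?thesis
    by (simp add: return_iter_def invariant_set_def)
next
  case False
  define y where "y = (return_inv B A h ^^ nat (- (k + 1))) x"
  have "nat (- k) = Suc (nat (- (k + 1)))"
    using False by simp
  then have "return_iter B A h k x = return_inv B A h y"
    using False by (simp add: return_iter_def y_def)
  \<comment> \<open>For \<open>k = -1\<close> the left side falls in the forward branch with no
    iterations, and both sides are \<open>x\<close>.\<close>
  moreover have "return_iter B A h (k + 1) x = y"
    using False by (simp add: return_iter_def y_def)
  moreover have "y \<in> return_map B A h ` return_dom B A h"
    using assms by (simp add: invariant_set_def y_def)
  ultimately show ?thesis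
    using return_inv_return_map by auto
qed

lemma return_map_invariant:
  assumes "x \<in> invariant_set B A h"
  shows "return_map B A h x \<in> invariant_set B A h"
    and "return_iter B A h k (return_map B A h x) = return_iter B A h (k + 1) x"
proof -
  have x: "x \<in> return_dom B A h"
    using return_iter_step[OF assms, of 0] by (simp add: return_iter_def)
  \<comment> \<open>The first backward step undoes the map, which moves the whole orbit by one
    index.\<close>
  have backward: "(return_inv B A h ^^ Suc n) (return_map B A h x) = (return_inv B A h ^^ n) x" for n
    by (simp add: funpow_swap1 return_inv_return_map[OF x])
  have forward: "(return_map B A h ^^ n) (return_map B A h x) = (return_map B A h ^^ Suc n) x" for n
    by (simp add: funpow_swap1)
  have "(return_inv B A h ^^ n) (return_map B A h x) \<in> return_map B A h ` return_dom B A h" for n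
  proof (cases n)
    case 0
    then show ?thesis
      using x by simp
  next
    case (Suc m)
    then show ?thesis
      using backward[of m] assms by (simp add: invariant_set_def)
  qed
  moreover have "(return_map B A h ^^ n) (return_map B A h x) \<in> return_dom B A h" for n
    unfolding forward using assms by (simp only: invariant_set_def mem_Collect_eq)
  ultimately show "return_map B A h x \<in> invariant_set B A h"
    by (simp add: invariant_set_def)
  show "return_iter B A h k (return_map B A h x) = return_iter B A h (k + 1) x"
  proof (cases "k \<ge> 0")
    case True
    then have "nat (k + 1) = Suc (nat k)"
      by simp
    then show ?thesis
      using True forward[of "nat k"] by (simp add: return_iter_def)
  next
    case False
    then have "nat (- k) = Suc (nat (- (k + 1)))"
      by simp
    then show ?thesis
      using False backward[of "nat (- (k + 1))"] by (auto simp: return_iter_def)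
  qed
qed

lemma coding_return_map:
  "x \<in> invariant_set B A h \<Longrightarrow> coding B A h (return_map B A h x) = shift (coding B A h x)"
  by (simp add: coding_def shift_def return_map_invariant(2))

lemma shift_asymmetric_words:
  assumes "l \<in> words B A - symmetric_words B A"
  shows "shift l \<in> words B A - symmetric_words B A"
proof -
  have l: "l \<in> words B A"
    using assms by blast
  then have "shift l \<in> words B A"
    unfolding words_def shift_def by blast
  moreover have "shift l \<notin> symmetric_words B A"
  proof
    assume "shift l \<in> symmetric_words B A"
    then obtain c where c: "l (c - k + 1) = l (k + 1)" for k
      unfolding symmetric_words_def shift_def by blast
    \<comment> \<open>Shifting moves the centre \<open>c / 2\<close> by one, so the constant
      \<open>c\<close> changes by two.\<close>
    have "l (c + 2 - k) = l k" for k
      using c[of "k - 1"] by (simp add: algebra_simps)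
    with l assms show False
      unfolding symmetric_words_def by blast
  qed
  ultimately show ?thesis
    by blast
qed

lemma return_map_asymmetric:
  "x \<in> asymmetric_set B A h \<Longrightarrow> return_map B A h x \<in> asymmetric_set B A h"
  unfolding asymmetric_set_def
  using return_map_invariant(1) coding_return_map shift_asymmetric_words by auto

section \<open>Retracing after a collision and symmetry of the word\<close>

lemma collision_retraces:
  assumes legs: "\<And>m :: int. legs (x m) (p m) (x (m + 1))"
    and collision: "x (k + 1) = flip (p k)"
  shows "x (k + 1 + int j) = flip (p (k - int j))"
proof (induction j)
  case 0
  show ?case
    using collision by simp
next
  case (Suc j)
  let ?m = "k + 1 + int j" and ?n = "k - int j"
  have m: "legs (x ?m) (p ?m) (x (?m + 1))" and n: "legs (x ?n) (p ?n) (x (?n + 1))"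
    and n': "legs (x (?n - 1)) (p (?n - 1)) (x ?n)"
    using legs[of ?m] legs[of ?n] legs[of "?n - 1"] by simp_all
  \<comment> \<open>By the induction hypothesis \<open>x ?m\<close> is \<open>flip (p ?n)\<close>,
    where the reversed outer leg of step \<open>?n\<close> begins; uniqueness then identifies the
    arrival \<open>p ?m\<close>.\<close>
  have "outer_leg B (x ?m) (flip (x ?n))"
    using Suc outer_leg_flip n unfolding legs_def by metis
  moreover have "outer_leg B (x ?m) (p ?m)"
    using m unfolding legs_def by blast
  ultimately have p: "p ?m = flip (x ?n)"
    using outer_leg_unique legs_interior(1)[OF n] legs_interior(2)[OF m] by simp
  \<comment> \<open>The inner leg of step \<open>?n - 1\<close> ends at \<open>x ?n\<close>, so
    reversed it starts at \<open>flip (x ?n)\<close>, which is \<open>p ?m\<close>, and competes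
    with the forward inner leg.\<close>
  obtain T z T' z' where "inner_leg B h (p ?m) (x (?m + 1)) T z"
      "inner_leg B h (p ?m) (flip (p (?n - 1))) T' z'"
    using m n' inner_leg_flip unfolding legs_def p by metis
  then have "x (?m + 1) = flip (p (?n - 1))"
    by (rule inner_leg_unique[where A = A and r\<^sub>1 = "symbol A (x (?m + 1))"
          and r\<^sub>2 = "symbol A (x (?n - 1))"])
      (use m n' legs_interior[OF m] legs_interior[OF n'] in \<open>simp_all add: legs_def\<close>)
  then show ?case
    by (simp add: algebra_simps)
qed

lemma collisional_imp_symmetric:
  assumes x: "x \<in> invariant_set B A h"
    and step: "return_step B A h (return_iter B A h k x) (return_iter B A h (k + 1) x) T z"
    and "collisional T z"
  shows "\<exists>c. \<forall>m. coding B A h x (c - m) = coding B A h x m"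
proof -
  define X where "X m = return_iter B A h m x" for m
  have "\<exists>p. legs (X m) p (X (m + 1))" for m
    unfolding X_def using return_iter_step[OF x, of m] return_dom_step return_step_legs by metis
  then obtain P where P: "legs (X m) (P m) (X (m + 1))" for m
    by metis
  obtain p where p: "legs (X k) p (X (k + 1))" "inner_leg B h p (X (k + 1)) T z"
    using step return_step_legs unfolding X_def by blast
  \<comment> \<open>The chosen arrival must be the one on the given collisional arc; the outer leg
    determines it.\<close>
  then have "P k = p"
    using outer_leg_legs_unique P by blast
  have "X (k + 1) = flip p"
    by (rule collisional_inner_leg[OF p(2) assms(3)])
      (use p(1) legs_interior[OF p(1)] in \<open>auto simp: legs_def\<close>)
  then have retrace: "X (k + 1 + int j) = flip (P (k - int j))" for j
    using collision_retraces[where x = X and p = P, OF P] \<open>P k = p\<close> by simp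
  have mirror: "symbol A (X (k + 1 + int j)) = symbol A (X (k - int j))" for j
    using retrace[of j] symbol_legs[OF P[of "k - int j"]] by (simp add: symbol_def)
  \<comment> \<open>The axis lies midway between the indices \<open>k\<close> and
    \<open>k + 1\<close>. The two cases read \<open>mirror\<close> from either side, with
    \<open>j\<close> the distance of \<open>m\<close> from \<open>k\<close> or from
    \<open>k + 1\<close>.\<close>
  have "symbol A (X (2 * k + 1 - m)) = symbol A (X m)" for m
  proof (cases "m \<le> k")
    case True
    then show ?thesis
      using mirror[of "nat (k - m)"] by (simp add: algebra_simps)
  next
    case False
    then show ?thesis
      using mirror[of "nat (m - k - 1)"] by (simp add: algebra_simps)
  qed
  then show ?thesis
    unfolding coding_def X_def by blast
qed

end

theorem corollary1p7:
  fixes B :: billiard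
  assumes "refraction_domain B" and "admissible B"
  shows "\<forall>A. admissible_family B A \<longrightarrow> (\<exists>h_bar>0. \<forall>h>h_bar.
    (\<forall>x\<in>asymmetric_set B A h.
       return_map B A h x \<in> asymmetric_set B A h \<and>
       coding B A h (return_map B A h x) = shift (coding B A h x)) \<and>
    (\<forall>x\<in>asymmetric_set B A h. \<forall>k::int. \<forall>T z.
       return_step B A h (return_iter B A h k x) (return_iter B A h (k + 1) x) T z
         \<longrightarrow> \<not> collisional T z))"
proof (intro allI impI exI[of _ "1 :: real"] conjI ballI)
  fix A h assume family: "admissible_family B A" and "h > (1 :: real)"
  \<comment> \<open>The threshold 1 is a convenient positive choice; it supplies
    \<open>h > 0\<close>, which the locale assumes.\<close>
  then interpret refraction_dynamics B h A
    by unfold_locales (use assms in auto)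
  fix x assume x: "x \<in> asymmetric_set B A h"
  then have inv: "x \<in> invariant_set B A h"
    by (simp add: asymmetric_set_def)
  show "return_map B A h x \<in> asymmetric_set B A h"
    using x by (rule return_map_asymmetric)
  show "coding B A h (return_map B A h x) = shift (coding B A h x)"
    using inv by (rule coding_return_map)
  fix k T z
  assume step: "return_step B A h (return_iter B A h k x) (return_iter B A h (k + 1) x) T z"
  show "\<not> collisional T z"
    using collisional_imp_symmetric[OF inv step] x
    unfolding asymmetric_set_def symmetric_words_def by blast
qed simp

end
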